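(* We have $$\sum_{r\geq2}\frac{F_{r-1}}{2^r}=1,\qquad \sum_{r\geq3}\frac{F_r-1}{2^r}=1.$$ Consequently, for every odd residue class $c$ modulo $12$, the set $\{s\in\mathbb N: s\equiv c\pmod{12},\ \ell(s)<\infty\}$ has full relative density in $[c]_{12}$; equivalently, its complement in $[c]_{12}$, the exceptional set $\{s\in\mathbb N: s\equiv c\pmod{12},\ \ell(s)=\infty\}$, has natural density zero. Moreover, for every $s$ in such an exceptional set, the trajectory of $s$ reaches $1$, i.e. $T^k(s)=1$ for some $k\geq0$.
   Context: $\mathbb N$ denotes the positive integers. The Collatz function $T:\mathbb N\to\mathbb N$ is $T(n)=n/2$ if $n$ is even and $T(n)=(3n+1)/2$ if $n$ is odd; $T^0(s)=s$ and $T^k(s)=T(T^{k-1}(s))$ for $k\geq1$; the trajectory of $s$ is $(T^k(s))_{k\geq0}$. For odd $s\in\mathbb N$, the cut time is $$\ell(s)=\min\{k\geq1 : T^k(s)\equiv 3\pmod 4 \text{ and } T^{k-1}(s)\text{ is even}\},$$ with $\ell(s)=\infty$ if this set is empty. $[a]_m=\{n\in\mathbb N: n\equiv a\pmod m\}$. The natural density of $A\subseteq\mathbb N$ is $\lim_{N\to\infty}|A\cap\{1,\dots,N\}|/N$; a subset $A\subseteq[c]_{12}$ has full relative density in $[c]_{12}$ if $|A\cap\{1,\dots,N\}|/|[c]_{12}\cap\{1,\dots,N\}|\to1$ as $N\to\infty$. The Fibonacci numbers are $F_0=0$, $F_1=1$, $F_{m+1}=F_m+F_{m-1}$ for $m\geq1$.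 *)

theory Defs
  imports "HOL-Number_Theory.Fib" "HOL-Number_Theory.Cong" "HOL-Library.Extended_Nat"
    "HOL-Analysis.Infinite_Sum"
begin

definition collatz :: "nat \<Rightarrow> nat" where
  "collatz n = (if even n then n div 2 else (3 * n + 1) div 2)"

definition cut_indices :: "nat \<Rightarrow> nat set" where
  "cut_indices s =
     {k. 1 \<le> k \<and> [(collatz ^^ k) s = 3] (mod 4) \<and> even ((collatz ^^ (k - 1)) s)}"

text \<open>The cut time is only meant to be used for odd arguments.\<close>

definition cut_time :: "nat \<Rightarrow> enat" where
  "cut_time s =
     (if cut_indices s = {} then \<infinity> else enat (LEAST k. k \<in> cut_indices s))"

text \<open>Residue classes and densities refer to the positive integers, so 0 is excluded.\<close>

definition residue_class :: "nat \<Rightarrow> nat \<Rightarrow> nat set" where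
  "residue_class a m = {n. 0 < n \<and> [n = a] (mod m)}"

definition has_natural_density :: "nat set \<Rightarrow> real \<Rightarrow> bool" where
  "has_natural_density A d \<longleftrightarrow>
     (\<lambda>N. real (card (A \<inter> {1..N})) / real N) \<longlonglongrightarrow> d"

definition has_full_relative_density :: "nat set \<Rightarrow> nat set \<Rightarrow> bool" where
  "has_full_relative_density A B \<longleftrightarrow>
     A \<subseteq> B \<and>
     (\<lambda>N. real (card (A \<inter> {1..N})) / real (card (B \<inter> {1..N}))) \<longlonglongrightarrow> 1"

end

(* A trajectory with infinite cut time never meets the parity pattern even, odd, odd, which at
   time j means that T^j(s) is congruent to 6 modulo 8. Since T^j(s + 2^j m) = T^j(s) + u m with
   u odd, the residues modulo 8 seen at times 0, 3, 6, ... are independent and uniform, so at most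
   7^k of the 8^k residue classes modulo 8^k avoid 6 at the first k of these times. Moreover,
   after its first even term such a trajectory has no term congruent to 3 modulo 4, and from then
   on T or T^2 decreases every term other than 1. *)

theory Submission
  imports Defs "HOL-Analysis.Elementary_Normed_Spaces"
begin

section \<open>The two Fibonacci series\<close>

text \<open>The base 7/4 works because 7/4 + 1 <= (7/4)^2, and it lies below 2, so F_n / 2^n tends
  to 0.\<close>

lemma fib_le_power: "real (fib n) \<le> (7 / 4) ^ n"
proof (induction n rule: fib.induct)
  case (3 n)
  have "real (fib (Suc (Suc n))) \<le> (7 / 4) ^ Suc n + (7 / 4) ^ n"
    using 3 by simp
  also have "\<dots> \<le> (7 / 4) ^ Suc (Suc n)"
    by simp
  finally show ?case .
qed simp_all

lemma fib_div_power2_tendsto_0: "(\<lambda>n. real (fib n) / 2 ^ n) \<longlonglongrightarrow> 0"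
proof (rule Lim_null_comparison)
  show "\<forall>\<^sub>F n in sequentially. norm (real (fib n) / 2 ^ n) \<le> (7 / 8) ^ n"
  proof (rule always_eventually, rule allI)
    fix n
    have "real (fib n) / 2 ^ n \<le> (7 / 4) ^ n / 2 ^ n"
      by (intro divide_right_mono fib_le_power) simp
    also have "\<dots> = (7 / 8) ^ n"
      by (simp flip: power_divide)
    finally show "norm (real (fib n) / 2 ^ n) \<le> (7 / 8) ^ n"
      by simp
  qed
qed (simp add: LIMSEQ_power_zero)

text \<open>The sum telescopes: F_(n+3) / 2^(n+1) - F_(n+4) / 2^(n+2) = F_(n+1) / 2^(n+2).\<close>

lemma sum_fib_div_power2:
  "(\<Sum>i<n. real (fib (i + 1)) / 2 ^ (i + 2)) = 1 - 4 * (real (fib (n + 3)) / 2 ^ (n + 3))"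
proof (induction n)
  case 0
  show ?case by (simp add: eval_nat_numeral)
next
  case (Suc n)
  show ?case
    unfolding sum.lessThan_Suc Suc by (simp add: field_simps eval_nat_numeral)
qed

lemma sums_fib_div_power2: "(\<lambda>i. real (fib (i + 1)) / 2 ^ (i + 2)) sums 1"
proof -
  have "(\<lambda>n. 1 - 4 * (real (fib (n + 3)) / 2 ^ (n + 3))) \<longlonglongrightarrow> 1 - 4 * 0"
    by (intro tendsto_intros LIMSEQ_ignore_initial_segment[OF fib_div_power2_tendsto_0])
  then show ?thesis
    unfolding sums_def sum_fib_div_power2 by simp
qed

lemma sums_fib_minus_1_div_power2: "(\<lambda>i. (real (fib (i + 3)) - 1) / 2 ^ (i + 3)) sums 1"
proof -
  \<comment> \<open>Dropping the first two terms 1/4 and 1/8 leaves 5/8. Doubling turns the index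
    shift into the sum 5/4 of F_r / 2^r over r >= 3, from which the geometric sum 1/4 is then
    subtracted.\<close>
  have "(\<lambda>i. real (fib (i + 2 + 1)) / 2 ^ (i + 2 + 2)) sums
      (1 - (\<Sum>i<2. real (fib (i + 1)) / 2 ^ (i + 2)))"
    by (rule sums_split_initial_segment[OF sums_fib_div_power2])
  from sums_mult[OF this, of 2]
  have "(\<lambda>i. 2 * (real (fib (i + 2 + 1)) / 2 ^ (i + 2 + 2))) sums (5 / 4)"
    by (simp add: eval_nat_numeral)
  moreover have "2 * (real (fib (i + 2 + 1)) / 2 ^ (i + 2 + 2)) = real (fib (i + 3)) / 2 ^ (i + 3)" for i
    by (simp add: field_simps eval_nat_numeral)
  ultimately have "(\<lambda>i. real (fib (i + 3)) / 2 ^ (i + 3)) sums (5 / 4)"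
    by simp
  moreover have "(\<lambda>i. 1 / 8 * (1 / 2) ^ i :: real) sums (1 / 8 * (1 / (1 - 1 / 2)))"
    by (intro sums_mult geometric_sums) simp
  ultimately have "(\<lambda>i. real (fib (i + 3)) / 2 ^ (i + 3) - 1 / 8 * (1 / 2) ^ i) sums
      (5 / 4 - 1 / 8 * (1 / (1 - 1 / 2)))"
    by (rule sums_diff)
  then show ?thesis
    by (simp add: diff_divide_distrib power_add power_divide mult.commute)
qed

text \<open>Nonnegative terms make convergence absolute, so the ordered sum is also the unordered
  sum over the shifted index set.\<close>

lemma sums_shift_imp_has_sum:
  fixes f :: "nat \<Rightarrow> real"
  assumes "(\<lambda>i. f (i + m)) sums s" and "\<And>i. 0 \<le> f (i + m)"
  shows "(f has_sum s) {m..}"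
proof -
  have "((\<lambda>i. f (i + m)) has_sum s) UNIV"
    using assms by (intro norm_summable_imp_has_sum) (auto simp: sums_iff)
  moreover have "(\<lambda>i. i + m) ` UNIV = {m..}"
    by (auto simp: image_iff) (metis add.commute le_iff_add)
  ultimately show ?thesis
    using has_sum_reindex[of "\<lambda>i. i + m" UNIV f s] by (simp add: o_def)
qed

section \<open>Iterates of the Collatz map along residue classes\<close>

lemma collatz_even: "even n \<Longrightarrow> collatz n = n div 2"
  and collatz_odd: "odd n \<Longrightarrow> collatz n = (3 * n + 1) div 2"
  by (simp_all add: collatz_def)

lemma collatz_6_mod_8:
  assumes "n mod 8 = 6"
  shows "even n" and "collatz n mod 4 = 3"
proof -
  show "even n"
    using assms by presburger
  then show "collatz n mod 4 = 3"
    using assms by (simp add: collatz_even) presburger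
qed

lemma collatz_1_mod_4:
  assumes "odd n" and "n mod 4 \<noteq> 3"
  shows "even (collatz n)"
  using assms by (simp add: collatz_odd) presburger

text \<open>An even increment keeps the parity, so the same affine branch applies. It halves the
  increment and, for odd \<open>n\<close>, also triples it, which preserves oddness of the
  coefficient.\<close>

lemma collatz_add_even:
  obtains v where "odd u \<Longrightarrow> odd v" and "\<And>m. collatz (n + 2 * (u * m)) = collatz n + v * m"
proof (cases "even n")
  case True
  then show ?thesis
    by (intro that[of u]) (simp_all add: collatz_def)
next
  case False
  have "(3 * (n + 2 * (u * m)) + 1) div 2 = (3 * n + 1) div 2 + 3 * u * m" for m
  proof -
    have "3 * (n + 2 * (u * m)) + 1 = 3 * n + 1 + (3 * u * m) * 2"
      by (simp add: algebra_simps)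
    then show ?thesis
      by (metis add.commute div_mult_self1 zero_neq_numeral)
  qed
  with False show ?thesis
    by (intro that[of "3 * u"]) (simp_all add: collatz_def)
qed

text \<open>Each step uses up one factor 2 of the increment; the coefficient \<open>u\<close> is 3
  to the number of odd terms among the first \<open>j\<close>.\<close>

lemma collatz_funpow_add_power2:
  "\<exists>u. odd u \<and> (\<forall>m. (collatz ^^ j) (s + 2 ^ j * m) = (collatz ^^ j) s + u * m)"
proof (induction j)
  case 0
  show ?case by (intro exI[of _ 1]) simp
next
  case (Suc j)
  then obtain u where u: "odd u" "\<And>m. (collatz ^^ j) (s + 2 ^ j * m) = (collatz ^^ j) s + u * m"
    by blast
  obtain v where v: "odd u \<Longrightarrow> odd v"
    "\<And>m. collatz ((collatz ^^ j) s + 2 * (u * m)) = collatz ((collatz ^^ j) s) + v * m"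
    using collatz_add_even[of u "(collatz ^^ j) s"] by blast
  have "(collatz ^^ Suc j) (s + 2 ^ Suc j * m) = (collatz ^^ Suc j) s + v * m" for m
    using u(2)[of "2 * m"] v(2)[of m] by (simp add: ac_simps)
  with u(1) v(1) show ?case by blast
qed

section \<open>Counting trajectories that avoid 6 modulo 8\<close>

text \<open>Times are sampled in steps of 3 because a residue modulo 8 is three binary digits: each
  test then depends on three fresh digits of \<open>s\<close>, one base-8 digit.\<close>

definition avoiding :: "nat \<Rightarrow> nat set" where
  "avoiding k = {s. \<forall>i<k. (collatz ^^ (3 * i)) s mod 8 \<noteq> 6}"

text \<open>A term 8q + 6 is even with successor 4q + 3, so the time after it would be a cut
  index.\<close>

lemma cut_indices_empty_imp_avoiding:
  assumes "cut_indices s = {}"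
  shows "s \<in> avoiding k"
proof -
  have False if "(collatz ^^ j) s mod 8 = 6" for j
  proof -
    have "Suc j \<in> cut_indices s"
      using collatz_6_mod_8[OF that] by (simp add: cut_indices_def cong_def)
    with assms show False by simp
  qed
  then show ?thesis
    by (auto simp: avoiding_def)
qed

text \<open>The residue modulo 8 at time 3i depends only on \<open>s\<close> modulo 8^(i+1), which
  divides 8^k for i < k.\<close>

lemma avoiding_add_power8: "s + 8 ^ k * m \<in> avoiding k \<longleftrightarrow> s \<in> avoiding k"
proof -
  have "(collatz ^^ (3 * i)) (s + 8 ^ k * m) mod 8 = (collatz ^^ (3 * i)) s mod 8"
    if less: "i < k" for i
  proof -
    obtain u where u: "\<And>m. (collatz ^^ (3 * i)) (s + 2 ^ (3 * i) * m) = (collatz ^^ (3 * i)) s + u * m"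
      using collatz_funpow_add_power2 by blast
    obtain d where "k = i + Suc d"
      using less_imp_Suc_add[OF less] by auto
    then have "s + 8 ^ k * m = s + 2 ^ (3 * i) * (8 * (8 ^ d * m))"
      by (simp add: power_add power_mult)
    then have "(collatz ^^ (3 * i)) (s + 8 ^ k * m) =
        (collatz ^^ (3 * i)) s + 8 * (u * (8 ^ d * m))"
      using u[of "8 * (8 ^ d * m)"] by (simp only: mult.left_commute)
    then show ?thesis by simp
  qed
  then show ?thesis
    by (simp add: avoiding_def)
qed

lemma mod_avoiding_iff: "s mod 8 ^ k \<in> avoiding k \<longleftrightarrow> s \<in> avoiding k"
  using avoiding_add_power8[of "s mod 8 ^ k" k "s div 8 ^ k"] by simp

lemma card_affine_mod_8_neq_6:
  assumes "odd (u :: nat)"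
  shows "card {m. m < 8 \<and> (a + u * m) mod 8 \<noteq> 6} \<le> 7"
proof -
  \<comment> \<open>Odd squares are 1 modulo 8, so the missing m is u (6 - a) modulo 8.\<close>
  define m0 where "m0 = u * (6 + 7 * a) mod 8"
  have "u mod 8 \<in> {..<8}" and "odd (u mod 8)"
    using assms by (simp_all add: dvd_mod_iff)
  then have "(u mod 8) * (u mod 8) mod 8 = 1"
    by (auto simp: lessThan_nat_numeral lessThan_Suc)
  then have "[u * u = 1] (mod 8)"
    by (simp add: cong_def mod_mult_eq)
  \<comment> \<open>Over the naturals \<open>7 * a\<close> plays the role of -a modulo 8.\<close>
  then have "[a + u * u * (6 + 7 * a) = a + 1 * (6 + 7 * a)] (mod 8)"
    by (intro cong_add cong_mult cong_refl)
  moreover have "(a + u * m0) mod 8 = (a + u * u * (6 + 7 * a)) mod 8"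
    unfolding m0_def by (metis mod_add_right_eq mod_mult_right_eq mult.assoc)
  ultimately have "(a + u * m0) mod 8 = (6 + 8 * a) mod 8"
    by (simp add: cong_def)
  then have "{m. m < 8 \<and> (a + u * m) mod 8 \<noteq> 6} \<subseteq> {..<8} - {m0}"
    by auto
  moreover have "card ({..<8} - {m0}) = 7"
    by (simp add: m0_def)
  ultimately show ?thesis
    by (metis card_mono finite_Diff finite_lessThan)
qed

text \<open>Induction on the number of base-8 digits. For a fixed lower part \<open>s\<close>, the
  new top digit m changes the iterate at time 3k to a + u m with \<open>u\<close> odd, which rules
  out one of the eight digits.\<close>

lemma card_avoiding: "card (avoiding k \<inter> {..<8 ^ k}) \<le> 7 ^ k"
proof (induction k)
  case 0
  have "avoiding 0 \<inter> {..<8 ^ 0} = {0}"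
    by (auto simp: avoiding_def)
  then show ?case by simp
next
  case (Suc k)
  define M where "M s = {m. m < 8 \<and> (collatz ^^ (3 * k)) (s + 8 ^ k * m) mod 8 \<noteq> 6}" for s
  have card_M: "card (M s) \<le> 7" for s
  proof -
    obtain u where "odd u"
      and "\<And>m. (collatz ^^ (3 * k)) (s + 2 ^ (3 * k) * m) = (collatz ^^ (3 * k)) s + u * m"
      using collatz_funpow_add_power2 by blast
    then show ?thesis
      using card_affine_mod_8_neq_6[of u "(collatz ^^ (3 * k)) s"] by (simp add: M_def power_mult)
  qed
  \<comment> \<open>Splitting off the top digit embeds the set into pairs of an avoiding lower part
    and an admissible digit from \<open>M\<close>.\<close>
  let ?f = "\<lambda>s. (s mod 8 ^ k, s div 8 ^ k)"
  have "inj_on ?f (avoiding (Suc k) \<inter> {..<8 ^ Suc k})"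
    by (rule inj_onI) (metis mod_mult_div_eq prod.inject)
  moreover have "?f ` (avoiding (Suc k) \<inter> {..<8 ^ Suc k}) \<subseteq> Sigma (avoiding k \<inter> {..<8 ^ k}) M"
  proof (rule image_subsetI)
    fix s :: nat
    assume s: "s \<in> avoiding (Suc k) \<inter> {..<8 ^ Suc k}"
    then have "s div 8 ^ k < 8"
      by (simp add: less_mult_imp_div_less)
    with s show "?f s \<in> Sigma (avoiding k \<inter> {..<8 ^ k}) M"
      by (simp add: M_def mod_avoiding_iff) (simp add: avoiding_def)
  qed
  moreover have fin: "finite (M s)" for s
    by (simp add: M_def)
  ultimately have "card (avoiding (Suc k) \<inter> {..<8 ^ Suc k}) \<le> card (Sigma (avoiding k \<inter> {..<8 ^ k}) M)"
    by (intro card_inj_on_le) auto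
  also have "\<dots> = (\<Sum>s \<in> avoiding k \<inter> {..<8 ^ k}. card (M s))"
    by (rule card_SigmaI) (use fin in auto)
  also have "\<dots> \<le> card (avoiding k \<inter> {..<8 ^ k}) * 7"
    using sum_bounded_above[of "avoiding k \<inter> {..<8 ^ k}" "\<lambda>s. card (M s)" 7] card_M by simp
  also have "\<dots> \<le> 7 ^ Suc k"
    using Suc.IH by simp
  finally show ?case .
qed

text \<open>Cut the range into blocks of length 8^k, each with at most 7^k avoiding members. The
  summand 7^k pays for the last, possibly incomplete block.\<close>

lemma card_avoiding_atMost: "real (card (avoiding k \<inter> {1..N})) \<le> (7 / 8) ^ k * real N + 7 ^ k"
proof -
  let ?f = "\<lambda>s. (s mod 8 ^ k, s div 8 ^ k)"
  have "inj_on ?f (avoiding k \<inter> {1..N})"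
    by (rule inj_onI) (metis mod_mult_div_eq prod.inject)
  moreover have "?f ` (avoiding k \<inter> {1..N}) \<subseteq> (avoiding k \<inter> {..<8 ^ k}) \<times> {..N div 8 ^ k}"
    by (auto simp: mod_avoiding_iff div_le_mono)
  ultimately have "card (avoiding k \<inter> {1..N}) \<le> card ((avoiding k \<inter> {..<8 ^ k}) \<times> {..N div 8 ^ k})"
    by (intro card_inj_on_le) auto
  also have "\<dots> \<le> 7 ^ k * Suc (N div 8 ^ k)"
    using card_avoiding[of k] by (simp add: card_cartesian_product del: mult_Suc_right)
  finally have "real (card (avoiding k \<inter> {1..N})) \<le> real (7 ^ k * Suc (N div 8 ^ k))"
    by (simp only: of_nat_le_iff)
  also have "\<dots> = 7 ^ k * real (N div 8 ^ k) + 7 ^ k"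
    by (simp add: algebra_simps)
  also have "\<dots> \<le> 7 ^ k * (real N / real (8 ^ k)) + 7 ^ k"
    by (intro add_right_mono mult_left_mono of_nat_div_le_of_nat) simp
  also have "\<dots> = (7 / 8) ^ k * real N + 7 ^ k"
    by (simp add: power_divide)
  finally show ?thesis .
qed

section \<open>Passage to densities\<close>

lemma density_zero_if_subset_avoiding:
  assumes "\<And>k. A \<subseteq> avoiding k"
  shows "has_natural_density A 0"
  unfolding has_natural_density_def
proof (rule LIMSEQ_I)
  fix e :: real
  assume "0 < e"
  \<comment> \<open>First \<open>k\<close> makes the linear coefficient small; only then is N taken
    large enough to absorb the constant 7^k.\<close>
  then obtain k where k: "(7 / 8) ^ k < e / 2"
    using real_arch_pow_inv[of "e / 2" "7 / 8"] by auto
  obtain N0 :: nat where N0: "7 ^ k / (e / 2) < real N0"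
    using reals_Archimedean2 by blast
  have "norm (real (card (A \<inter> {1..N})) / real N - 0) < e" if "N \<ge> Suc N0" for N
  proof -
    have N: "0 < real N" "7 ^ k < e / 2 * real N"
      using that N0 \<open>0 < e\<close> by (auto simp: field_simps intro: less_le_trans)
    have "card (A \<inter> {1..N}) \<le> card (avoiding k \<inter> {1..N})"
      using assms by (intro card_mono) auto
    then have "real (card (A \<inter> {1..N})) \<le> (7 / 8) ^ k * real N + 7 ^ k"
      using card_avoiding_atMost[of k N] by linarith
    also have "\<dots> < e / 2 * real N + e / 2 * real N"
      using N k by (intro add_strict_mono mult_strict_right_mono)
    finally have "real (card (A \<inter> {1..N})) < e * real N"
      by simp
    with N show ?thesis
      by (simp add: divide_less_eq)
  qed
  then show "\<exists>N0. \<forall>N\<ge>N0. norm (real (card (A \<inter> {1..N})) / real N - 0) < e"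
    by blast
qed

lemma card_residue_class_ge:
  assumes "0 < m"
  shows "N div m \<le> card (residue_class a m \<inter> {1..N})"
proof -
  \<comment> \<open>The representative is taken in 1..m rather than 0..m-1, since 0 is excluded from
    residue classes.\<close>
  obtain r where r: "0 < r" "r \<le> m" "[r = a] (mod m)"
  proof (cases "a mod m = 0")
    case True
    with assms show ?thesis by (intro that[of m]) (simp_all add: cong_def)
  next
    case False
    with assms show ?thesis by (intro that[of "a mod m"]) (simp_all add: cong_def)
  qed
  have "m * j + r \<in> residue_class a m \<inter> {1..N}" if "j < N div m" for j
  proof -
    have "m * j + r \<le> m * Suc j"
      using r(2) by simp
    also have "\<dots> \<le> m * (N div m)"
      using that by (intro mult_le_mono2) simp
    also have "\<dots> \<le> N"
      by simp
    finally show ?thesis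
      using r by (simp add: residue_class_def cong_def)
  qed
  then have "(\<lambda>j. m * j + r) ` {..<N div m} \<subseteq> residue_class a m \<inter> {1..N}"
    by auto
  moreover have "inj_on (\<lambda>j. m * j + r) {..<N div m}"
    using assms by (simp add: inj_on_def)
  ultimately show ?thesis
    by (metis card_inj_on_le card_lessThan finite_Int finite_atLeastAtMost)
qed

text \<open>The class has positive lower density, so density zero of \<open>E\<close> forces its
  relative density to vanish too.\<close>

lemma full_relative_density_if_complement_density_zero:
  assumes "has_natural_density E 0" and "0 < m" and E: "E \<subseteq> residue_class a m"
  shows "has_full_relative_density (residue_class a m - E) (residue_class a m)"
proof -
  let ?B = "residue_class a m"
  let ?b = "\<lambda>N. real (card (?B \<inter> {1..N}))" and ?e = "\<lambda>N. real (card (E \<inter> {1..N}))"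
  \<comment> \<open>For N >= 2m, N div m > N/m - 1 >= N/(2m).\<close>
  have lower: "real N / (2 * real m) \<le> ?b N" if "N \<ge> 2 * m" for N
  proof -
    have "N < m * Suc (N div m)"
      using dividend_less_times_div[OF \<open>0 < m\<close>] by simp
    then have "real N < real (m * Suc (N div m))"
      by (simp only: of_nat_less_iff)
    then have "real N < real m * (real (N div m) + 1)"
      by (simp add: algebra_simps)
    moreover have "real N \<ge> 2 * real m"
      using that by linarith
    ultimately have "real N / (2 * real m) \<le> real (N div m)"
      using \<open>0 < m\<close> by (simp add: divide_le_eq algebra_simps)
    also have "\<dots> \<le> ?b N"
      using card_residue_class_ge[OF \<open>0 < m\<close>] by simp
    finally show ?thesis .
  qed
  have "(\<lambda>N. ?e N / ?b N) \<longlonglongrightarrow> 0"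
  proof (rule Lim_null_comparison)
    show "\<forall>\<^sub>F N in sequentially. norm (?e N / ?b N) \<le> 2 * real m * (?e N / real N)"
      using eventually_ge_at_top[of "2 * m"]
    proof eventually_elim
      case (elim N)
      then have "0 < real N / (2 * real m)"
        using \<open>0 < m\<close> by simp
      then have "?e N / ?b N \<le> ?e N / (real N / (2 * real m))"
        using lower[OF elim] by (intro divide_left_mono mult_pos_pos) linarith+
      then show ?case
        by (simp add: mult_ac)
    qed
    show "(\<lambda>N. 2 * real m * (?e N / real N)) \<longlonglongrightarrow> 0"
      using tendsto_mult_right_zero[OF assms(1)[unfolded has_natural_density_def]] .
  qed
  then have "(\<lambda>N. 1 - ?e N / ?b N) \<longlonglongrightarrow> 1 - 0"
    by (intro tendsto_intros)
  \<comment> \<open>The identity needs a nonzero denominator, which \<open>lower\<close> provides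
    from 2m on.\<close>
  moreover have "\<forall>\<^sub>F N in sequentially.
      1 - ?e N / ?b N = real (card ((?B - E) \<inter> {1..N})) / ?b N"
    using eventually_ge_at_top[of "2 * m"]
  proof eventually_elim
    case (elim N)
    then have "0 < real N / (2 * real m)"
      using \<open>0 < m\<close> by simp
    then have "0 < ?b N"
      using lower[OF elim] by linarith
    have "(?B - E) \<inter> {1..N} = ?B \<inter> {1..N} - E \<inter> {1..N}"
      by blast
    moreover have "E \<inter> {1..N} \<subseteq> ?B \<inter> {1..N}"
      using E by blast
    ultimately have "real (card ((?B - E) \<inter> {1..N})) = ?b N - ?e N"
      by (simp add: card_Diff_subset card_mono of_nat_diff)
    moreover have "1 = ?b N / ?b N"
      using \<open>0 < ?b N\<close> by (metis divide_self less_irrefl)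
    ultimately show ?case
      by (metis diff_divide_distrib)
  qed
  ultimately show ?thesis
    unfolding has_full_relative_density_def by (auto intro: Lim_transform_eventually)
qed

section \<open>Exceptional trajectories reach 1\<close>

lemma collatz_pos: "0 < n \<Longrightarrow> 0 < collatz n"
  by (auto simp: collatz_def elim!: evenE)

text \<open>An odd step multiplies n + 1 by 3/2. If all terms were odd, every 2^k would divide s +
  1; k = s + 1 is already too large.\<close>

lemma collatz_trajectory_meets_even: "\<exists>k. even ((collatz ^^ k) s)"
proof (rule ccontr)
  assume "\<not> ?thesis"
  then have odd: "odd ((collatz ^^ k) s)" for k
    by simp
  have eq: "2 ^ k * ((collatz ^^ k) s + 1) = 3 ^ k * (s + 1)" for k
  proof (induction k)
    case (Suc k)
    have "2 * ((collatz ^^ Suc k) s + 1) = 3 * ((collatz ^^ k) s + 1)"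
      using odd[of k] by (auto simp: collatz_odd elim!: oddE)
    then have "2 ^ Suc k * ((collatz ^^ Suc k) s + 1) = 3 * (2 ^ k * ((collatz ^^ k) s + 1))"
      by (metis mult.assoc mult.left_commute power_Suc2)
    with Suc show ?case by simp
  qed simp
  have "(2::nat) ^ (s + 1) dvd 3 ^ (s + 1) * (s + 1)"
    using eq[of "s + 1"] by (metis dvd_triv_left)
  moreover have "coprime ((2::nat) ^ (s + 1)) (3 ^ (s + 1))"
    by (intro coprime_power_left_iff[THEN iffD2] coprime_power_right_iff[THEN iffD2]) auto
  ultimately have "(2::nat) ^ (s + 1) dvd s + 1"
    using coprime_dvd_mult_right_iff by blast
  then have "2 ^ (s + 1) \<le> s + 1"
    by (rule dvd_imp_le) simp
  with less_exp[of "s + 1"] show False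
    by linarith
qed

text \<open>Strong induction by descent: an even term is halved, and 4q + 1 with q > 0 reaches 3q +
  1 in two steps. The hypothesis passes to all later terms.\<close>

lemma collatz_reaches_1_if_no_3_mod_4:
  assumes "0 < n" and "\<And>k. (collatz ^^ k) n mod 4 \<noteq> 3"
  shows "\<exists>k. (collatz ^^ k) n = 1"
  using assms
proof (induction n rule: less_induct)
  case (less n)
  have descend: ?case if "(collatz ^^ j) n < n" for j
  proof -
    have "0 < (collatz ^^ j) n"
      by (induction j) (use less.prems(1) collatz_pos in auto)
    moreover have "(collatz ^^ k) ((collatz ^^ j) n) mod 4 \<noteq> 3" for k
      using less.prems(2)[of "k + j"] by (simp add: funpow_add)
    ultimately obtain k where "(collatz ^^ k) ((collatz ^^ j) n) = 1"
      using less.IH \<open>(collatz ^^ j) n < n\<close> by blast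
    then have "(collatz ^^ (k + j)) n = 1"
      by (simp add: funpow_add)
    then show ?thesis ..
  qed
  consider "n = 1" | "even n" | q where "n = 4 * q + 1" "0 < q"
  proof -
    have "n = 1 \<or> even n \<or> (n = 4 * (n div 4) + 1 \<and> 0 < n div 4)"
      using less.prems(2)[of 0] by (simp, presburger)
    then show ?thesis using that by blast
  qed
  then show ?case
  proof cases
    case 1
    then have "(collatz ^^ 0) n = 1" by simp
    then show ?thesis ..
  next
    case 2
    then show ?thesis
      using less.prems(1) by (intro descend[of 1]) (simp add: collatz_even)
  next
    case 3
    then have "collatz n = 2 * (3 * q + 1)"
      by (simp add: collatz_odd)
    then have "collatz (collatz n) = 3 * q + 1"
      using collatz_even[of "2 * (3 * q + 1)"] by simp
    then have "(collatz ^^ 2) n < n"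
      using 3 by (simp only: numeral_2_eq_2 funpow.simps o_apply id_apply)
    then show ?thesis
      by (rule descend)
  qed
qed

lemma cut_indices_empty_imp_reaches_1:
  assumes "0 < s" and "cut_indices s = {}"
  shows "\<exists>k. (collatz ^^ k) s = 1"
proof -
  obtain k0 where k0: "even ((collatz ^^ k0) s)"
    using collatz_trajectory_meets_even by blast
  \<comment> \<open>Invariant from an even term on: after an even term, 3 modulo 4 would give a cut
    index; an odd term is 1 modulo 4, so its successor is even.\<close>
  have no_3: "(collatz ^^ (j + k0)) s mod 4 \<noteq> 3" for j
  proof (induction j)
    case 0
    with k0 show ?case by (simp, presburger)
  next
    case (Suc j)
    let ?x = "(collatz ^^ (j + k0)) s"
    show ?case
    proof (cases "even ?x")
      case True
      have "Suc (j + k0) \<notin> cut_indices s"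
        using assms(2) by simp
      with True show ?thesis
        by (simp add: cut_indices_def cong_def)
    next
      case False
      with Suc.IH have "even (collatz ?x)"
        by (intro collatz_1_mod_4)
      then show ?thesis
        by (simp, presburger)
    qed
  qed
  have "0 < (collatz ^^ k0) s"
    by (induction k0) (use assms(1) collatz_pos in auto)
  moreover have "(collatz ^^ k) ((collatz ^^ k0) s) mod 4 \<noteq> 3" for k
    using no_3[of k] by (simp add: funpow_add)
  ultimately obtain k where "(collatz ^^ k) ((collatz ^^ k0) s) = 1"
    using collatz_reaches_1_if_no_3_mod_4 by blast
  then have "(collatz ^^ (k + k0)) s = 1"
    by (simp add: funpow_add)
  then show ?thesis ..
qed

theorem corollary4p5:
  shows "((\<lambda>r::nat. real (fib (r - 1)) / 2 ^ r) has_sum 1) {2..} \<and>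
    ((\<lambda>r::nat. (real (fib r) - 1) / 2 ^ r) has_sum 1) {3..} \<and>
    (\<forall>c::nat. odd c \<longrightarrow>
       has_full_relative_density {s \<in> residue_class c 12. cut_time s < \<infinity>} (residue_class c 12) \<and>
       has_natural_density {s \<in> residue_class c 12. cut_time s = \<infinity>} 0 \<and>
       (\<forall>s \<in> {s \<in> residue_class c 12. cut_time s = \<infinity>}. \<exists>k. (collatz ^^ k) s = 1))"
proof (intro conjI allI impI)
  show "((\<lambda>r::nat. real (fib (r - 1)) / 2 ^ r) has_sum 1) {2..}"
    using sums_fib_div_power2 by (intro sums_shift_imp_has_sum) simp_all
  \<comment> \<open>This gives the nonnegative terms that the unordered sum requires.\<close>
  have "1 \<le> real (fib (i + 3))" for i
    using fib_neq_0_nat[of "i + 3"] by simp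
  then show "((\<lambda>r::nat. (real (fib r) - 1) / 2 ^ r) has_sum 1) {3..}"
    using sums_fib_minus_1_div_power2 by (intro sums_shift_imp_has_sum) simp_all
next
  fix c :: nat
  let ?E = "{s \<in> residue_class c 12. cut_time s = \<infinity>}"
  have infinite: "cut_indices s = {}" if "cut_time s = \<infinity>" for s
    using that by (simp add: cut_time_def split: if_splits)
  then have "?E \<subseteq> avoiding k" for k
    using cut_indices_empty_imp_avoiding by blast
  then show density: "has_natural_density ?E 0"
    by (rule density_zero_if_subset_avoiding)
  have "{s \<in> residue_class c 12. cut_time s < \<infinity>} = residue_class c 12 - ?E"
    by auto
  then show "has_full_relative_density {s \<in> residue_class c 12. cut_time s < \<infinity>} (residue_class c 12)"
    using full_relative_density_if_complement_density_zero[OF density] by simp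
  show "\<forall>s \<in> ?E. \<exists>k. (collatz ^^ k) s = 1"
    using infinite cut_indices_empty_imp_reaches_1 by (simp add: residue_class_def)
qed

end
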